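(* Let $\mathbf{Y}\in\mathbb{R}^n$, $\mathbf{f}_1,\dots,\mathbf{f}_M\in\mathbb{R}^n$, $\boldsymbol{\pi}\in\Lambda^M$, $\nu\in(0,1)$, $\omega>0$, and suppose there is a constant $L\in\mathbb{R}$ with $\|\mathbf{f}_j\|_2\le L$ for all $j=1,\dots,M$. Let $\boldsymbol{\psi}^{(k)}$, $k\ge1$, be the iterates of the greedy algorithm GMA-BMAX described in the context. Then for every $k\ge 1$, $$\log J(\boldsymbol{\psi}^{(k)})\le\log J(\boldsymbol{\psi}_X(\omega^2,\nu))+\frac{8A_3}{k+3},\qquad A_3=\left(\frac{1-\nu}{\omega^2}\right)L^2+\left(\frac{1-\nu}{\omega^2}\right)^2L^4.$$
   Context: $\Lambda^M=\{\boldsymbol{\lambda}\in\mathbb{R}^M:\lambda_j\ge 0,\ \sum_{j=1}^M\lambda_j=1\}$. Define $$J(\boldsymbol{\psi})=\sum_{j=1}^M\pi_j\exp\left(-\frac{1}{2\omega^2}\|\mathbf{f}_j-\mathbf{Y}\|_2^2+\frac{1-\nu}{2\omega^2}\|\boldsymbol{\psi}-\mathbf{f}_j\|_2^2\right),\qquad\boldsymbol{\psi}_X(\omega^2,\nu)=\operatorname*{argmin}_{\boldsymbol{\psi}\in\mathbb{R}^n}J(\boldsymbol{\psi}).$$ Algorithm GMA-BMAX: set $\boldsymbol{\psi}^{(0)}=0$; for $k=1,2,\dots$ set $\alpha_k=\frac{2}{k+1}$, choose $J^{(k)}\in\operatorname*{argmin}_{j\in\{1,\dots,M\}}\log J\big(\boldsymbol{\psi}^{(k-1)}+\alpha_k(\mathbf{f}_j-\boldsymbol{\psi}^{(k-1)})\big)$,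 and set $\boldsymbol{\psi}^{(k)}=\boldsymbol{\psi}^{(k-1)}+\alpha_k(\mathbf{f}_{J^{(k)}}-\boldsymbol{\psi}^{(k-1)})$. *)

theory Defs
  imports "HOL-Analysis.Analysis"
begin

unbundle vec_syntax

definition prob_simplex :: "(real ^ 'm::finite) set" where
  "prob_simplex = {l. (\<forall>j. 0 \<le> l $ j) \<and> (\<Sum>j\<in>UNIV. l $ j) = 1}"

definition J_obj ::
    "real ^ 'n \<Rightarrow> ('m::finite \<Rightarrow> real ^ 'n) \<Rightarrow> real ^ 'm \<Rightarrow> real \<Rightarrow> real \<Rightarrow> real ^ 'n \<Rightarrow> real" where
  "J_obj Y f p \<nu> \<omega> \<psi> =
     (\<Sum>j\<in>UNIV. p $ j *
        exp (- (1 / (2 * \<omega>\<^sup>2)) * (norm (f j - Y))\<^sup>2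
             + (1 - \<nu>) / (2 * \<omega>\<^sup>2) * (norm (\<psi> - f j))\<^sup>2))"

definition psi_X ::
    "real ^ 'n \<Rightarrow> ('m::finite \<Rightarrow> real ^ 'n) \<Rightarrow> real ^ 'm \<Rightarrow> real \<Rightarrow> real \<Rightarrow> real ^ 'n" where
  "psi_X Y f p \<nu> \<omega> = arg_min (J_obj Y f p \<nu> \<omega>) (\<lambda>_. True)"

definition gma_step :: "nat \<Rightarrow> real" where
  "gma_step k = 2 / (real k + 1)"

(* The greedy index need not be unique, so the algorithm is a relation: psi is a run of it
   that selects the index s k at step k.  The value s 0 plays no role. *)
definition gma_bmax_run ::
    "real ^ 'n \<Rightarrow> ('m::finite \<Rightarrow> real ^ 'n) \<Rightarrow> real ^ 'm \<Rightarrow> real \<Rightarrow> real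
      \<Rightarrow> (nat \<Rightarrow> 'm) \<Rightarrow> (nat \<Rightarrow> real ^ 'n) \<Rightarrow> bool" where
  "gma_bmax_run Y f p \<nu> \<omega> s \<psi> \<longleftrightarrow>
     \<psi> 0 = 0 \<and>
     (\<forall>k\<ge>1.
        is_arg_min
          (\<lambda>j. ln (J_obj Y f p \<nu> \<omega> (\<psi> (k - 1) + gma_step k *\<^sub>R (f j - \<psi> (k - 1)))))
          (\<lambda>_. True) (s k) \<and>
        \<psi> k = \<psi> (k - 1) + gma_step k *\<^sub>R (f (s k) - \<psi> (k - 1)))"

end

theory Submission
  imports Defs "HOL-Probability.Hoeffding"
begin

text \<open>
  Up to the factor $\exp (c \|v\|^2 / 2)$, with $c = (1-\nu)/\omega^2$, the ratio
  $J(\psi + v) / J(\psi)$ is the moment generating function of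
  $c \langle \psi - f_j, v\rangle$ under the weights proportional to the summands of $J(\psi)$.
  Jensen's inequality and Hoeffding's lemma then give
  $\langle \nabla, v\rangle \le \log J(\psi+v) - \log J(\psi) \le
    \langle \nabla, v\rangle + \frac{1}{2}(c + c^2 L^2)\|v\|^2$, without computing a Hessian.
  The upper bound forces the gradient to vanish at a minimizer, which is therefore a convex
  combination of the $f_j$. Bounding the greedy choice by the average over the $f_j$ with these
  convex weights yields the Frank-Wolfe recursion $h_k \le (1-\alpha_k) h_{k-1} + 2 A_3 \alpha_k^2$
  for the excess $h_k$, and $8 A_3/(k+3)$ solves it.
\<close>

section \<open>Exponential moments under finite weights\<close>

text \<open>Convexity puts \<open>exp\<close> below its chord over [d - r, d + r], so the sum is at
  most the moment generating function of a two-point law with the same mean. The centre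
  \<open>d\<close> may differ from that mean.\<close>

lemma sum_exp_le_Hoeffding:
  fixes q b :: "'a \<Rightarrow> real"
  assumes "finite S" "\<And>j. j \<in> S \<Longrightarrow> 0 \<le> q j" "sum q S = 1"
    and bd: "\<And>j. j \<in> S \<Longrightarrow> \<bar>b j - d\<bar> \<le> r" and "0 \<le> r"
  shows "(\<Sum>j\<in>S. q j * exp (b j)) \<le> exp ((\<Sum>j\<in>S. q j * b j) + r\<^sup>2 / 2)"
proof (cases "r = 0")
  case True
  then have "b j = d" if "j \<in> S" for j
    using bd[OF that] by simp
  then show ?thesis
    using assms(3) True by (simp flip: sum_distrib_right)
next
  case False
  with \<open>0 \<le> r\<close> have r: "0 < r" by simp
  \<comment> \<open>Relative position of \<open>b j\<close> in the interval [d - r, d + r]; the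
    division by its length is why r = 0 is treated apart.\<close>
  define \<theta> where "\<theta> j = (b j - d + r) / (2 * r)" for j
  define P where "P = (\<Sum>j\<in>S. q j * \<theta> j)"
  have \<theta>: "0 \<le> \<theta> j" "\<theta> j \<le> 1" if "j \<in> S" for j
    using bd[OF that] r by (auto simp: \<theta>_def field_simps)
  have "0 \<le> P"
    unfolding P_def using assms(2) \<theta> by (intro sum_nonneg) auto
  have P_eq: "2 * r * P = (\<Sum>j\<in>S. q j * b j) - d + r"
  proof -
    have "2 * r * P = (\<Sum>j\<in>S. q j * b j + q j * (r - d))"
      unfolding P_def sum_distrib_left
      using r by (intro sum.cong) (auto simp: \<theta>_def field_simps)
    then show ?thesis
      using assms(3) by (simp add: sum.distrib flip: sum_distrib_right)
  qed
  have chord: "exp (b j) \<le> exp (d - r) * (1 + \<theta> j * (exp (2 * r) - 1))" if "j \<in> S" for j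
  proof -
    have "exp (1 * ((1 - \<theta> j) *\<^sub>R (d - r) + \<theta> j *\<^sub>R (d + r)))
        \<le> (1 - \<theta> j) * exp (1 * (d - r)) + \<theta> j * exp (1 * (d + r))"
      using convex_onD[OF convex_on_exp[of 1] \<theta>[OF that]] by simp
    moreover have "(1 - \<theta> j) *\<^sub>R (d - r) + \<theta> j *\<^sub>R (d + r) = b j"
      using r by (simp add: \<theta>_def field_simps)
    moreover have "exp (d + r) = exp (d - r) * exp (2 * r)"
      by (simp flip: exp_add)
    ultimately show ?thesis
      by (simp add: algebra_simps)
  qed
  have pos: "0 < 1 + P * (exp (2 * r) - 1)"
    using \<open>0 \<le> P\<close> r by (simp add: add_pos_nonneg)
  have "(\<Sum>j\<in>S. q j * exp (b j)) \<le> (\<Sum>j\<in>S. q j * (exp (d - r) * (1 + \<theta> j * (exp (2 * r) - 1))))"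
    using assms(2) chord by (intro sum_mono mult_left_mono) auto
  also have "\<dots> = (\<Sum>j\<in>S. q j * exp (d - r) + q j * \<theta> j * (exp (d - r) * (exp (2 * r) - 1)))"
    by (intro sum.cong) (simp_all add: algebra_simps)
  also have "\<dots> = exp (d - r) * (1 + P * (exp (2 * r) - 1))"
    unfolding sum.distrib sum_distrib_right[symmetric] assms(3) P_def[symmetric]
    by (simp add: algebra_simps)
  also have "\<dots> = exp (d - r + ln (1 + P * (exp (2 * r) - 1)))"
    using pos by (simp add: exp_add)
  \<comment> \<open>For mass \<open>P\<close> at h and the rest at 0, the log moment generating
    function exceeds the mean h * P by at most h^2 / 8; here h = 2 * r.\<close>
  also have "\<dots> \<le> exp (d - r + (2 * r * P + r\<^sup>2 / 2))"
    using Hoeffdings_lemma_aux[of "2 * r" P] \<open>0 \<le> P\<close> r by (simp add: power2_eq_square)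
  also have "\<dots> = exp ((\<Sum>j\<in>S. q j * b j) + r\<^sup>2 / 2)"
    by (simp add: P_eq)
  finally show ?thesis .
qed

text \<open>The tangent to \<open>exp\<close> at the mean \<open>m\<close> lies below
  \<open>exp\<close> and averages to \<open>exp m\<close>.\<close>

lemma exp_sum_le_Jensen:
  fixes q b :: "'a \<Rightarrow> real"
  assumes "\<And>j. j \<in> S \<Longrightarrow> 0 \<le> q j" "sum q S = 1"
  shows "exp (\<Sum>j\<in>S. q j * b j) \<le> (\<Sum>j\<in>S. q j * exp (b j))"
proof -
  define m where "m = (\<Sum>j\<in>S. q j * b j)"
  have "exp m = (\<Sum>j\<in>S. q j * (exp m * (1 + (b j - m))))"
  proof -
    have "(\<Sum>j\<in>S. q j * (exp m * (1 + (b j - m))))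
        = (\<Sum>j\<in>S. q j * (exp m * (1 - m)) + q j * b j * exp m)"
      by (intro sum.cong) (simp_all add: algebra_simps)
    also have "\<dots> = exp m * (1 - m) + m * exp m"
      by (simp add: m_def assms(2) sum.distrib flip: sum_distrib_right)
    finally show ?thesis by (simp add: algebra_simps)
  qed
  also have "\<dots> \<le> (\<Sum>j\<in>S. q j * exp (b j))"
  proof (intro sum_mono mult_left_mono)
    fix j
    have "exp m * (1 + (b j - m)) \<le> exp m * exp (b j - m)"
      by (intro mult_left_mono exp_ge_add_one_self) simp
    then show "exp m * (1 + (b j - m)) \<le> exp (b j)"
      by (simp flip: exp_add)
  qed (use assms(1) in auto)
  finally show ?thesis by (simp add: m_def)
qed

section \<open>First-order bounds for the logarithm of the objective\<close>

text \<open>The weights \<open>w\<close> absorb every factor of the objective that does not depend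
  on its argument, so they need not sum to 1.\<close>

locale exp_quadratic_mixture =
  fixes c L :: real and w :: "'m::finite \<Rightarrow> real" and f :: "'m \<Rightarrow> 'a::euclidean_space"
  assumes c_pos: "0 < c"
    and w_nonneg: "\<And>j. 0 \<le> w j"
    and w_pos: "\<exists>j. 0 < w j"
    and norm_f_le: "\<And>j. norm (f j) \<le> L"
begin

definition term_at :: "'a \<Rightarrow> 'm \<Rightarrow> real" where
  "term_at x j = w j * exp (c / 2 * (norm (x - f j))\<^sup>2)"

definition Z :: "'a \<Rightarrow> real" where
  "Z x = (\<Sum>j\<in>UNIV. term_at x j)"

definition q :: "'a \<Rightarrow> 'm \<Rightarrow> real" where
  "q x j = term_at x j / Z x"

text \<open>The gradient of \<open>ln (Z x)\<close>, used only as the linear term of the two bounds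
  below and never obtained by differentiation.\<close>

definition grad :: "'a \<Rightarrow> 'a" where
  "grad x = c *\<^sub>R (x - (\<Sum>j\<in>UNIV. q x j *\<^sub>R f j))"

lemma L_nonneg: "0 \<le> L"
  using norm_f_le order_trans norm_ge_zero by blast

lemma term_at_nonneg: "0 \<le> term_at x j"
  by (simp add: term_at_def w_nonneg)

lemma Z_pos: "0 < Z x"
proof -
  obtain j where "0 < w j" using w_pos by blast
  then have "0 < term_at x j" by (simp add: term_at_def)
  then show ?thesis
    unfolding Z_def by (intro sum_pos2[of _ j]) (auto simp: term_at_nonneg)
qed

lemma q_nonneg: "0 \<le> q x j"
  by (simp add: q_def term_at_nonneg Z_pos less_imp_le)

lemma sum_q: "(\<Sum>j\<in>UNIV. q x j) = 1"
  using Z_pos[of x] by (simp add: q_def Z_def flip: sum_divide_distrib)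

lemma sum_q_inner: "(\<Sum>j\<in>UNIV. q x j * (c * ((x - f j) \<bullet> v))) = grad x \<bullet> v"
proof -
  have "(\<Sum>j\<in>UNIV. q x j * (c * ((x - f j) \<bullet> v)))
      = (\<Sum>j\<in>UNIV. q x j * (c * (x \<bullet> v)) - c * ((q x j *\<^sub>R f j) \<bullet> v))"
    by (intro sum.cong) (simp_all add: algebra_simps)
  also have "\<dots> = c * (x \<bullet> v) - c * (\<Sum>j\<in>UNIV. (q x j *\<^sub>R f j) \<bullet> v)"
    by (simp add: sum_subtractf sum_q flip: sum_distrib_right sum_distrib_left)
  also have "\<dots> = grad x \<bullet> v"
    by (simp add: grad_def inner_sum_left inner_diff_left right_diff_distrib)
  finally show ?thesis .
qed

lemma Z_add:
  "Z (x + v) = Z x * (exp (c / 2 * (norm v)\<^sup>2) * (\<Sum>j\<in>UNIV. q x j * exp (c * ((x - f j) \<bullet> v))))"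
proof -
  have "term_at (x + v) j
      = exp (c / 2 * (norm v)\<^sup>2) * (term_at x j * exp (c * ((x - f j) \<bullet> v)))" for j
  proof -
    have "(norm (x + v - f j))\<^sup>2 = (norm (x - f j))\<^sup>2 + 2 * ((x - f j) \<bullet> v) + (norm v)\<^sup>2"
      unfolding power2_norm_eq_inner by (simp add: algebra_simps inner_commute)
    then have "c / 2 * (norm (x + v - f j))\<^sup>2
        = c / 2 * (norm v)\<^sup>2 + (c / 2 * (norm (x - f j))\<^sup>2 + c * ((x - f j) \<bullet> v))"
      by (simp add: distrib_left)
    then show ?thesis
      by (simp only: term_at_def exp_add) simp
  qed
  moreover have "term_at x j = Z x * q x j" for j
    using Z_pos[of x] by (simp add: q_def)
  ultimately show ?thesis
    unfolding Z_def[of "x + v"] by (simp add: sum_distrib_left mult_ac)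
qed

lemma ln_Z_add_ge: "ln (Z x) + grad x \<bullet> v \<le> ln (Z (x + v))"
proof -
  have "Z x * exp (grad x \<bullet> v) \<le> Z x * (1 * (\<Sum>j\<in>UNIV. q x j * exp (c * ((x - f j) \<bullet> v))))"
    using exp_sum_le_Jensen[of UNIV "q x" "\<lambda>j. c * ((x - f j) \<bullet> v)"] Z_pos[of x]
    by (simp add: q_nonneg sum_q sum_q_inner)
  \<comment> \<open>The 1 makes room for the factor \<open>exp (c / 2 * (norm v)\<^sup>2)\<close>,
    which is at least 1.\<close>
  also have "\<dots> \<le> Z (x + v)"
    unfolding Z_add using Z_pos[of x] c_pos
    by (intro mult_left_mono mult_right_mono sum_nonneg) (auto simp: q_nonneg)
  finally have "ln (Z x * exp (grad x \<bullet> v)) \<le> ln (Z (x + v))"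
    using Z_pos by simp
  then show ?thesis
    using Z_pos[of x] by (simp add: ln_mult)
qed

text \<open>In the smoothness constant, \<open>c\<close> comes from the common factor in
  \<open>Z_add\<close> and \<open>c\<^sup>2 * L\<^sup>2\<close> from Hoeffding's bound with radius
  \<open>c * (L * norm v)\<close>.\<close>

lemma ln_Z_add_le:
  "ln (Z (x + v)) \<le> ln (Z x) + grad x \<bullet> v + (c + c\<^sup>2 * L\<^sup>2) / 2 * (norm v)\<^sup>2"
proof -
  \<comment> \<open>Only \<open>f j \<bullet> v\<close> varies with \<open>j\<close>; centring at
    \<open>c * (x \<bullet> v)\<close> makes the radius independent of \<open>x\<close>.\<close>
  have "\<bar>c * ((x - f j) \<bullet> v) - c * (x \<bullet> v)\<bar> \<le> c * (L * norm v)" for j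
  proof -
    have "\<bar>f j \<bullet> v\<bar> \<le> norm (f j) * norm v"
      by (rule Cauchy_Schwarz_ineq2)
    also have "\<dots> \<le> L * norm v"
      by (intro mult_right_mono norm_f_le) simp
    finally have "c * \<bar>f j \<bullet> v\<bar> \<le> c * (L * norm v)"
      using c_pos by simp
    moreover have "c * ((x - f j) \<bullet> v) - c * (x \<bullet> v) = - (c * (f j \<bullet> v))"
      by (simp add: algebra_simps)
    ultimately show ?thesis
      using c_pos by (simp add: abs_mult)
  qed
  then have "(\<Sum>j\<in>UNIV. q x j * exp (c * ((x - f j) \<bullet> v)))
      \<le> exp (grad x \<bullet> v + (c * (L * norm v))\<^sup>2 / 2)"
    using sum_exp_le_Hoeffding[where S = UNIV and q = "q x" and r = "c * (L * norm v)"
        and b = "\<lambda>j. c * ((x - f j) \<bullet> v)" and d = "c * (x \<bullet> v)"] L_nonneg c_pos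
    by (simp add: sum_q_inner q_nonneg sum_q)
  then have "Z (x + v)
      \<le> Z x * (exp (c / 2 * (norm v)\<^sup>2) * exp (grad x \<bullet> v + (c * (L * norm v))\<^sup>2 / 2))"
    unfolding Z_add using Z_pos[of x] by simp
  also have "\<dots> = Z x * exp (grad x \<bullet> v + (c + c\<^sup>2 * L\<^sup>2) / 2 * (norm v)\<^sup>2)"
    by (simp add: power_mult_distrib add_divide_distrib algebra_simps flip: exp_add)
  finally have "ln (Z (x + v)) \<le> ln (Z x * exp (grad x \<bullet> v + (c + c\<^sup>2 * L\<^sup>2) / 2 * (norm v)\<^sup>2))"
    using Z_pos by simp
  then show ?thesis
    using Z_pos[of x] by (simp add: ln_mult)
qed

section \<open>Existence and location of minimizers\<close>

text \<open>Coercivity: far from \<open>f i\<close>, a single summand of positive weight already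
  exceeds \<open>Z (f i)\<close>, so a minimum over a compact ball is global.\<close>

lemma Z_attains_min: "\<exists>x. \<forall>y. Z x \<le> Z y"
proof -
  obtain i where i: "0 < w i" using w_pos by blast
  \<comment> \<open>Chosen so that \<open>w i * (c / 2 * R\<^sup>2)\<close> equals
    \<open>Z (f i)\<close>; the bound exp t \<ge> t then suffices outside the ball.\<close>
  define R where "R = sqrt (2 * Z (f i) / (w i * c))"
  have R: "0 \<le> R" "R\<^sup>2 = 2 * Z (f i) / (w i * c)"
    using Z_pos[of "f i"] i c_pos by (auto simp: R_def)
  have "continuous_on (cball (f i) R) Z"
    unfolding Z_def term_at_def by (intro continuous_intros)
  then obtain x where x: "x \<in> cball (f i) R" "\<And>y. y \<in> cball (f i) R \<Longrightarrow> Z x \<le> Z y"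
    using continuous_attains_inf[of "cball (f i) R" Z] R(1) by auto
  have "Z x \<le> Z y" for y
  proof (cases "y \<in> cball (f i) R")
    case False
    then have "R \<le> norm (y - f i)"
      by (simp add: dist_norm norm_minus_commute)
    then have "R\<^sup>2 \<le> (norm (y - f i))\<^sup>2"
      using R(1) by (rule power_mono)
    have "Z x \<le> Z (f i)"
      using x(2) R(1) by simp
    also have "\<dots> = w i * (c / 2 * R\<^sup>2)"
      using R(2) i c_pos by simp
    also have "\<dots> \<le> w i * exp (c / 2 * (norm (y - f i))\<^sup>2)"
    proof (intro mult_left_mono)
      have "c / 2 * R\<^sup>2 \<le> c / 2 * (norm (y - f i))\<^sup>2"
        using \<open>R\<^sup>2 \<le> _\<close> c_pos by simp
      also have "\<dots> \<le> exp (c / 2 * (norm (y - f i))\<^sup>2)"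
        using exp_ge_add_one_self[of "c / 2 * (norm (y - f i))\<^sup>2"] by linarith
      finally show "c / 2 * R\<^sup>2 \<le> exp (c / 2 * (norm (y - f i))\<^sup>2)" .
    qed (use i in simp)
    also have "\<dots> \<le> Z y"
      unfolding Z_def term_at_def[symmetric]
      by (intro member_le_sum) (auto simp: term_at_nonneg)
    finally show ?thesis .
  qed (rule x(2))
  then show ?thesis by blast
qed

text \<open>A gradient step of length 1 / K would lower \<open>ln (Z x)\<close> by at least
  \<open>(norm (grad x))\<^sup>2 / (2 * K)\<close>, so \<open>grad x\<close> vanishes.\<close>

lemma minimizer_eq_weighted_mean:
  assumes "\<And>y. Z x \<le> Z y"
  shows "x = (\<Sum>j\<in>UNIV. q x j *\<^sub>R f j)"
proof -
  define K where "K = c + c\<^sup>2 * L\<^sup>2"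
  have K: "0 < K"
    unfolding K_def using c_pos by (intro add_pos_nonneg) auto
  have "ln (Z x) \<le> ln (Z (x + (- 1 / K) *\<^sub>R grad x))"
    using assms Z_pos by simp
  also have "\<dots> \<le> ln (Z x) + grad x \<bullet> ((- 1 / K) *\<^sub>R grad x)
      + K / 2 * (norm ((- 1 / K) *\<^sub>R grad x))\<^sup>2"
    unfolding K_def by (rule ln_Z_add_le)
  also have "\<dots> = ln (Z x) - (norm (grad x))\<^sup>2 / (2 * K)"
    using K by (simp add: power2_norm_eq_inner[symmetric] power_mult_distrib power_divide)
      (simp add: field_simps power2_eq_square)
  finally have "(norm (grad x))\<^sup>2 / (2 * K) \<le> 0"
    by simp
  then have "grad x = 0"
    using K by (simp add: divide_le_0_iff)
  then show ?thesis
    using c_pos by (simp add: grad_def)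
qed

section \<open>Progress of one greedy step\<close>

lemma greedy_step:
  assumes min: "\<And>z. Z x \<le> Z z" and y: "norm y \<le> L"
    and greedy: "\<And>j. ln (Z (y + a *\<^sub>R (f i - y))) \<le> ln (Z (y + a *\<^sub>R (f j - y)))"
    and a: "0 \<le> a"
  shows "ln (Z (y + a *\<^sub>R (f i - y))) - ln (Z x)
    \<le> (1 - a) * (ln (Z y) - ln (Z x)) + 2 * (c * L\<^sup>2 + c\<^sup>2 * L ^ 4) * a\<^sup>2"
proof -
  \<comment> \<open>The quadratic term of \<open>ln_Z_add_le\<close> for a displacement of norm at
    most a * 2 * L, since \<open>f j\<close> and \<open>y\<close> both lie in the ball of radius
    \<open>L\<close>.\<close>
  define B where "B = 2 * (c * L\<^sup>2 + c\<^sup>2 * L ^ 4) * a\<^sup>2"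
  have step: "ln (Z (y + a *\<^sub>R (f j - y))) \<le> ln (Z y) + B + a * (grad y \<bullet> (f j - y))" for j
  proof -
    have "norm (f j - y) \<le> 2 * L"
      using norm_triangle_ineq4[of "f j" y] norm_f_le[of j] y by linarith
    then have "(norm (f j - y))\<^sup>2 \<le> (2 * L)\<^sup>2"
      by (intro power_mono) auto
    then have "(c + c\<^sup>2 * L\<^sup>2) / 2 * (a\<^sup>2 * (norm (f j - y))\<^sup>2)
        \<le> (c + c\<^sup>2 * L\<^sup>2) / 2 * (a\<^sup>2 * (2 * L)\<^sup>2)"
      using c_pos by (intro mult_left_mono) auto
    also have "\<dots> = B"
      by (simp add: B_def power2_eq_square power4_eq_xxxx algebra_simps)
    finally show ?thesis
      using ln_Z_add_le[of y "a *\<^sub>R (f j - y)"] by (simp add: power_mult_distrib)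
  qed
  have x: "x = (\<Sum>j\<in>UNIV. q x j *\<^sub>R f j)"
    by (rule minimizer_eq_weighted_mean[OF min])
  have "ln (Z (y + a *\<^sub>R (f i - y)))
      = (\<Sum>j\<in>UNIV. q x j * ln (Z (y + a *\<^sub>R (f i - y))))"
    by (simp add: sum_q flip: sum_distrib_right)
  \<comment> \<open>The weights are those of the minimizer \<open>x\<close>, not of
    \<open>y\<close>: under them \<open>f j\<close> averages to \<open>x\<close>, so the mean
    direction is \<open>x - y\<close>.\<close>
  also have "\<dots> \<le> (\<Sum>j\<in>UNIV. q x j * (ln (Z y) + B + a * (grad y \<bullet> (f j - y))))"
    by (intro sum_mono mult_left_mono order_trans[OF greedy step] q_nonneg)
  also have "\<dots> = (\<Sum>j\<in>UNIV. q x j * (ln (Z y) + B - a * (grad y \<bullet> y))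
      + a * (grad y \<bullet> (q x j *\<^sub>R f j)))"
    by (intro sum.cong) (simp_all add: algebra_simps)
  also have "\<dots> = ln (Z y) + B - a * (grad y \<bullet> y) + a * (grad y \<bullet> (\<Sum>j\<in>UNIV. q x j *\<^sub>R f j))"
    by (simp add: sum.distrib sum_q inner_sum_right flip: sum_distrib_right sum_distrib_left)
  also have "\<dots> = ln (Z y) + B + a * (grad y \<bullet> (x - y))"
    by (simp add: inner_diff_right right_diff_distrib flip: x)
  \<comment> \<open>The lower bound at \<open>y\<close> turns the slope towards \<open>x\<close>
    into the gap in value.\<close>
  also have "\<dots> \<le> ln (Z y) + B + a * (ln (Z x) - ln (Z y))"
    using ln_Z_add_ge[of y "x - y"] a by (intro add_left_mono mult_left_mono) auto
  finally show ?thesis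
    by (simp add: B_def algebra_simps)
qed

end

section \<open>Solving the recursion\<close>

lemma frank_wolfe_rate:
  fixes h :: "nat \<Rightarrow> real"
  assumes rec: "\<And>k. h (Suc k) \<le> (1 - gma_step (Suc k)) * h k + 2 * A * (gma_step (Suc k))\<^sup>2"
    and "0 \<le> A" and "1 \<le> k"
  shows "h k \<le> 8 * A / (real k + 3)"
  using \<open>1 \<le> k\<close>
proof (induction k rule: dec_induct)
  case base
  show ?case
    \<comment> \<open>The first step has size 1, which erases \<open>h 0\<close> and leaves 2 * A =
      8 * A / (1 + 3).\<close>
    using rec[of 0] by (simp add: gma_step_def)
next
  case (step k)
  define t where "t = real k"
  have t: "1 \<le> t"
    using step by (simp add: t_def)
  have "h (Suc k) \<le> (1 - 2 / (t + 2)) * h k + 2 * A * (2 / (t + 2))\<^sup>2"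
    using rec[of k] by (simp add: gma_step_def t_def add.commute)
  also have "\<dots> \<le> (1 - 2 / (t + 2)) * (8 * A / (t + 3)) + 2 * A * (2 / (t + 2))\<^sup>2"
    using step.IH t by (intro add_right_mono mult_left_mono) (auto simp: t_def)
  also have "\<dots> = 8 * A * (t / ((t + 2) * (t + 3)) + 1 / (t + 2)\<^sup>2)"
    using t by (simp add: power2_eq_square divide_simps) (simp add: algebra_simps)
  also have "\<dots> \<le> 8 * A * (1 / (t + 4))"
  proof (intro mult_left_mono)
    have div_le: "u / v \<le> 1 / (t + 4)" if "u * (t + 4) \<le> v" "0 < v" for u v
      using that t by (simp add: field_simps)
    have "t / ((t + 2) * (t + 3)) + 1 / (t + 2)\<^sup>2
        = (t * (t + 2) + (t + 3)) / ((t + 2)\<^sup>2 * (t + 3))"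
      using t by (simp add: power2_eq_square divide_simps)
    also have "\<dots> \<le> 1 / (t + 4)"
    proof (rule div_le)
      \<comment> \<open>After expansion the right side exceeds the left by exactly
        \<open>t\<close>.\<close>
      show "(t * (t + 2) + (t + 3)) * (t + 4) \<le> (t + 2)\<^sup>2 * (t + 3)"
        using t by (simp add: power2_eq_square algebra_simps)
    qed (use t in simp)
    finally show "t / ((t + 2) * (t + 3)) + 1 / (t + 2)\<^sup>2 \<le> 1 / (t + 4)" .
  qed (use \<open>0 \<le> A\<close> in simp)
  finally show ?case
    by (simp add: t_def add.commute)
qed

section \<open>Application to GMA-BMAX\<close>

theorem proposition2:
  fixes Y :: "real ^ 'n"
    and f :: "'m::finite \<Rightarrow> real ^ 'n"
    and p :: "real ^ 'm"
    and \<nu> \<omega> L A\<^sub>3 :: real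
    and s :: "nat \<Rightarrow> 'm"
    and \<psi> :: "nat \<Rightarrow> real ^ 'n"
    and k :: nat
  assumes "p \<in> prob_simplex"
    and "0 < \<nu>" and "\<nu> < 1"
    and "0 < \<omega>"
    and "\<And>j. norm (f j) \<le> L"
    and "gma_bmax_run Y f p \<nu> \<omega> s \<psi>"
    and "A\<^sub>3 = (1 - \<nu>) / \<omega>\<^sup>2 * L\<^sup>2 + ((1 - \<nu>) / \<omega>\<^sup>2)\<^sup>2 * L ^ 4"
    and "1 \<le> k"
  shows "ln (J_obj Y f p \<nu> \<omega> (\<psi> k))
           \<le> ln (J_obj Y f p \<nu> \<omega> (psi_X Y f p \<nu> \<omega>)) + 8 * A\<^sub>3 / (real k + 3)"
proof -
  define c where "c = (1 - \<nu>) / \<omega>\<^sup>2"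
  define w where "w j = p $ j * exp (- (1 / (2 * \<omega>\<^sup>2)) * (norm (f j - Y))\<^sup>2)" for j
  have p: "\<And>j. 0 \<le> p $ j" "(\<Sum>j\<in>UNIV. p $ j) = 1"
    using assms(1) by (auto simp: prob_simplex_def)
  interpret exp_quadratic_mixture c L w f
  proof
    show "0 < c"
      using assms(3,4) by (simp add: c_def)
    show "0 \<le> w j" for j
      by (simp add: w_def p)
    have "\<exists>j. p $ j \<noteq> 0"
      using p(2) by (metis sum.neutral zero_neq_one)
    then show "\<exists>j. 0 < w j"
      using p(1) by (force simp: w_def less_le)
  qed (rule assms(5))
  have J: "J_obj Y f p \<nu> \<omega> = Z"
  proof -
    have "J_obj Y f p \<nu> \<omega> y = Z y" for y
      unfolding Z_def term_at_def
      by (simp add: J_obj_def w_def c_def mult.assoc mult.commute[of "\<omega>\<^sup>2" 2] flip: exp_add)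
    then show ?thesis by (rule ext)
  qed
  define x where "x = psi_X Y f p \<nu> \<omega>"
  \<comment> \<open>\<open>psi_X\<close> is a Hilbert choice; existence of a minimizer ensures that
    the chosen point is one.\<close>
  have min: "Z x \<le> Z y" for y
  proof -
    have "is_arg_min Z (\<lambda>_. True) x"
      unfolding x_def psi_X_def J arg_min_def
      by (rule someI_ex) (simp add: is_arg_min_linorder Z_attains_min)
    then show ?thesis
      by (simp add: is_arg_min_linorder)
  qed
  have \<psi>0: "\<psi> 0 = 0"
    using assms(6) by (simp add: gma_bmax_run_def)
  have run: "is_arg_min (\<lambda>j. ln (Z (\<psi> i + gma_step (Suc i) *\<^sub>R (f j - \<psi> i)))) (\<lambda>_. True) (s (Suc i))
      \<and> \<psi> (Suc i) = \<psi> i + gma_step (Suc i) *\<^sub>R (f (s (Suc i)) - \<psi> i)" for i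
  proof -
    have "1 \<le> Suc i" by simp
    with assms(6) show ?thesis
      unfolding gma_bmax_run_def J by (metis diff_Suc_1)
  qed
  then have \<psi>_Suc: "\<psi> (Suc i) = \<psi> i + gma_step (Suc i) *\<^sub>R (f (s (Suc i)) - \<psi> i)" for i
    by blast
  have greedy: "ln (Z (\<psi> i + gma_step (Suc i) *\<^sub>R (f (s (Suc i)) - \<psi> i)))
      \<le> ln (Z (\<psi> i + gma_step (Suc i) *\<^sub>R (f j - \<psi> i)))" for i j
    using run[of i] by (simp add: is_arg_min_linorder del: ln_le_cancel_iff)
  have step_bounds: "0 \<le> gma_step (Suc i)" "gma_step (Suc i) \<le> 1" for i
    by (auto simp: gma_step_def)
  \<comment> \<open>Starting from 0, each iterate is a convex combination of its predecessor and
    some \<open>f j\<close>, so it stays in the ball of radius \<open>L\<close>.\<close>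
  have norm_\<psi>: "norm (\<psi> i) \<le> L" for i
  proof (induction i)
    case 0
    show ?case by (simp add: \<psi>0 L_nonneg)
  next
    case (Suc i)
    have "(1 - gma_step (Suc i)) *\<^sub>R \<psi> i + gma_step (Suc i) *\<^sub>R f (s (Suc i)) \<in> cball 0 L"
      using Suc norm_f_le step_bounds[of i]
      by (intro convexD[OF convex_cball]) auto
    then show ?case
      by (simp add: \<psi>_Suc algebra_simps)
  qed
  have "ln (Z (\<psi> (Suc i))) - ln (Z x)
      \<le> (1 - gma_step (Suc i)) * (ln (Z (\<psi> i)) - ln (Z x)) + 2 * A\<^sub>3 * (gma_step (Suc i))\<^sup>2" for i
    using greedy_step[OF min norm_\<psi> greedy step_bounds(1)]
    by (simp add: \<psi>_Suc assms(7) c_def)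
  moreover have "0 \<le> A\<^sub>3"
    using c_pos unfolding assms(7) c_def[symmetric] by simp
  ultimately have "ln (Z (\<psi> k)) - ln (Z x) \<le> 8 * A\<^sub>3 / (real k + 3)"
    using frank_wolfe_rate[of "\<lambda>i. ln (Z (\<psi> i)) - ln (Z x)" A\<^sub>3 k] \<open>1 \<le> k\<close> by blast
  then show ?thesis
    by (simp add: J x_def)
qed

end
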